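(* Let $1\le p<\infty$ with conjugate exponent $q$, $\frac1p+\frac1q=1$. Let $d_i>0$, $G_i>0$, $F_i>0$, $a_{ij},b_{ij}\in\mathbf R$, $\tau_{ij}\ge0$ be constants, $i,j=1,\dots,n$. Suppose there are positive constants $\epsilon$, $\xi_i$ and real constants $\alpha_{ij}$, $\beta_{ij}$, $i,j=1,\dots,n$, such that one of the following two sets of inequalities holds: either for all $i=1,\dots,n$ $$(-d_i+\epsilon)\xi_i+G_i\Big[\xi_i|a_{ii}|+\frac1p\sum_{j\ne i}\xi_j|a_{ji}|^{\alpha_{ji}p}\Big]+\frac1q\xi_i\sum_{j\ne i}G_j|a_{ij}|^{(1-\alpha_{ij})q}+\frac1pF_i\sum_{j=1}^n\xi_j|b_{ji}|^{\beta_{ji}p}e^{\epsilon\tau_{ji}}+\frac1q\xi_i\sum_{j=1}^nF_j|b_{ij}|^{(1-\beta_{ij})q}e^{\epsilon\tau_{ij}}\le 0,$$ or for all $i=1,\dots,n$ $$(-d_i+\epsilon)\xi_i+G_i\Big[\xi_i|a_{ii}|+\frac1p\sum_{j\ne i}\xi_j|a_{ji}|\Big]+\frac1q\xi_i\sum_{j\ne i}G_j|a_{ij}|+\frac1pF_i\sum_{j=1}^n\xi_j|b_{ji}|e^{\epsilon\tau_{ji}}+\frac1q\xi_i\sum_{j=1}^nF_j|b_{ij}|e^{\epsilon\tau_{ij}}\le 0.$$ Then there exist positive constants $\theta_1,\dots,\theta_n$ such that for all $i=1,\dots,n$ $$(-d_i+\epsilon)\theta_i+G_i\Big[\theta_i|a_{ii}|+\sum_{j\ne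 i}\theta_j|a_{ji}|\Big]+F_i\sum_{j=1}^n\theta_j|b_{ji}|e^{\epsilon\tau_{ji}}\le 0 .$$
   Context: All quantities are real numbers. Convention for $p=1$: $\frac1q=0$, one takes $\alpha_{ij}=\beta_{ij}=1$, and the terms with the factor $\frac1q$ are absent. *)

theory Defs
  imports Complex_Main
begin

text \<open>
  Real powers of nonnegative bases with \<open>0\<^sup>0 = 1\<close>; the library has \<open>0 powr 0 = 0\<close>.
  A negative power of 0 is mathematically undefined and gets the value 0 here.
\<close>
definition rpow :: "real \<Rightarrow> real \<Rightarrow> real" where
  "rpow x s = (if s = 0 then 1 else x powr s)"

text \<open>
  The factor \<open>1/q\<close> for the conjugate exponent \<open>q\<close> of \<open>p\<close>. For \<open>p = 1\<close> one has
  \<open>q = \<infinity>\<close>, which no real \<open>q\<close> can represent: the factor is then 0 whatever \<open>q\<close> is,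
  so that the terms containing it vanish.
\<close>
definition conj_recip :: "real \<Rightarrow> real \<Rightarrow> real" where
  "conj_recip p q = (if p = 1 then 0 else 1 / q)"

end

theory Submission
  imports Defs "HOL-Analysis.Convex"
begin

text \<open>
  Put \<open>C\<^sub>j\<^sub>i = [j \<noteq> i] G\<^sub>i \<bar>a\<^sub>j\<^sub>i\<bar> + F\<^sub>i \<bar>b\<^sub>j\<^sub>i\<bar> e\<^bsup>\<epsilon>\<tau>\<^sub>j\<^sub>i\<^esup>\<close> and \<open>D\<^sub>i = d\<^sub>i - \<epsilon> - G\<^sub>i \<bar>a\<^sub>i\<^sub>i\<bar>\<close>. What is wanted is
  a positive row vector \<open>\<theta>\<close> with \<open>\<theta> (diag D - C) \<ge> 0\<close>. By linear duality (\<open>stiemke_alternative\<close>),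
  if there is none, then some column vector \<open>y \<ge> 0\<close> satisfies \<open>D\<^sub>j y\<^sub>j \<le> (C y)\<^sub>j\<close> for all \<open>j\<close>, strictly for at least
  one \<open>j\<close>.

  Such a \<open>y\<close> contradicts the hypothesis, by the argument behind Ostrowski's bound of a spectral
  radius by a geometric mean of row and column sums (\<open>ostrowski_positive_vector\<close>): multiply the
  \<open>j\<close>-th inequality by \<open>\<xi>\<^sub>j y\<^sub>j\<^bsup>p-1\<^esup>\<close> and split each product \<open>C\<^sub>j\<^sub>i y\<^sub>i y\<^sub>j\<^bsup>p-1\<^esup>\<close> by Young's inequality
  into a multiple \<open>U\<^sub>j\<^sub>i/p\<close> of \<open>y\<^sub>i\<^sup>p\<close> and a multiple \<open>V\<^sub>j\<^sub>i/q\<close> of \<open>y\<^sub>j\<^sup>p\<close>, where \<open>C \<le> U\<^bsup>1/p\<^esup> V\<^bsup>1/q\<^esup>\<close>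
  entrywise. After summation over \<open>j\<close> the coefficient of \<open>y\<^sub>i\<^sup>p\<close> on the right is
  \<open>\<Sum>\<^sub>j \<xi>\<^sub>j U\<^sub>j\<^sub>i / p + \<xi>\<^sub>i \<Sum>\<^sub>j V\<^sub>i\<^sub>j / q\<close>, which the hypothesis bounds by \<open>\<xi>\<^sub>i D\<^sub>i\<close>, the coefficient
  on the left, while the one strict inequality makes the left side strictly smaller.

  The duality argument, rather than a Perron eigenvector, copes with reducible \<open>C\<close> in the
  borderline case of spectral radius 1, where a positive \<open>\<theta>\<close> need not exist for a general
  nonnegative matrix. Both sets of inequalities have the shape required:
  the first corresponds to the factorization
  \<open>\<bar>a\<bar> = (\<bar>a\<bar>\<^bsup>\<alpha>p\<^esup>)\<^bsup>1/p\<^esup> (\<bar>a\<bar>\<^bsup>(1-\<alpha>)q\<^esup>)\<^bsup>1/q\<^esup>\<close>, the second to \<open>\<bar>a\<bar> = \<bar>a\<bar>\<^bsup>1/p\<^esup> \<bar>a\<bar>\<^bsup>1/q\<^esup>\<close>, for nonzero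
  entries. The argument uses \<open>1/q\<close> only as \<open>1 - 1/p\<close>, so that it includes \<open>p = 1\<close>.
\<close>

section \<open>Linear alternatives\<close>

text \<open>
  Bartl's induction on the number of vectors \<open>A k\<close>. A point \<open>x\<close> that separates \<open>g\<close> from all vectors
  but one, \<open>A m\<close>, is either good for \<open>A m\<close> as well or has \<open>A m \<cdot> x > 0\<close>; in that case all vectors are
  projected along \<open>A m\<close> onto the annihilator of \<open>x\<close>, and the induction hypothesis is applied to the
  projections.
\<close>

lemma farkas_alternative:
  fixes A :: "'k \<Rightarrow> 'j \<Rightarrow> real" and g :: "'j \<Rightarrow> real"
  assumes "finite K" and J: "finite J"
  shows "(\<exists>l. (\<forall>k\<in>K. 0 \<le> l k) \<and> (\<forall>j\<in>J. g j = (\<Sum>k\<in>K. l k * A k j))) \<or>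
         (\<exists>x. (\<forall>k\<in>K. (\<Sum>j\<in>J. A k j * x j) \<le> 0) \<and> 0 < (\<Sum>j\<in>J. g j * x j))"
  using \<open>finite K\<close>
proof (induction K arbitrary: A g rule: finite_induct)
  case empty
  show ?case
  proof (cases "\<forall>j\<in>J. g j = 0")
    case False
    then obtain j where "j \<in> J" "g j \<noteq> 0" by blast
    then have "0 < (\<Sum>j\<in>J. g j * g j)"
      by (intro sum_pos2[OF J, of j]) (auto simp: zero_less_mult_iff)
    then show ?thesis by auto
  qed auto
next
  case (insert m K)
  let ?dot = "\<lambda>u x. \<Sum>j\<in>J. u j * x j"
  consider (comb) l where "\<forall>k\<in>K. 0 \<le> l k" "\<forall>j\<in>J. g j = (\<Sum>k\<in>K. l k * A k j)"
    | (sep) x where "\<forall>k\<in>K. ?dot (A k) x \<le> 0" "0 < ?dot g x"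
    using insert.IH[of g A] by blast
  then show ?case
  proof cases
    case comb
    have "(\<Sum>k\<in>K. l k * A k j) = (\<Sum>k\<in>K. (l(m := 0)) k * A k j)" for j
      using insert.hyps by (intro sum.cong) auto
    with comb show ?thesis
      using insert.hyps by (intro disjI1 exI[of _ "l(m := 0)"]) auto
  next
    case sep
    show ?thesis
    proof (cases "?dot (A m) x \<le> 0")
      case True
      with sep show ?thesis by blast
    next
      case False
      define c where "c = ?dot (A m) x"
      have c: "c > 0" using False by (simp add: c_def)
      \<comment> \<open>\<open>proj u\<close> is \<open>u\<close> moved along \<open>A m\<close> so that it vanishes on \<open>x\<close>.\<close>
      define proj where "proj u j = u j - ?dot u x / c * A m j" for u j
      have dot_proj: "?dot (proj u) z = ?dot u (\<lambda>j. z j - ?dot (A m) z / c * x j)" for u z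
        by (simp add: proj_def algebra_simps sum_subtractf sum_distrib_left sum_distrib_right
                      sum_divide_distrib)
           (subst sum.swap, simp add: algebra_simps)
      consider (comb') l where "\<forall>k\<in>K. 0 \<le> l k" "\<forall>j\<in>J. proj g j = (\<Sum>k\<in>K. l k * proj (A k) j)"
        | (sep') z where "\<forall>k\<in>K. ?dot (proj (A k)) z \<le> 0" "0 < ?dot (proj g) z"
        using insert.IH[of "proj g" "\<lambda>k. proj (A k)"] by blast
      then show ?thesis
      proof cases
        case comb'
        \<comment> \<open>Undoing the projections collects this multiple of \<open>A m\<close>.\<close>
        define r where "r = (?dot g x - (\<Sum>k\<in>K. l k * ?dot (A k) x)) / c"
        have "(\<Sum>k\<in>K. l k * ?dot (A k) x) \<le> 0"
          using comb' sep by (intro sum_nonpos) (auto simp: mult_le_0_iff)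
        then have r: "0 \<le> r" using sep c by (simp add: r_def)
        have "g j = (\<Sum>k\<in>insert m K. (l(m := r)) k * A k j)" if "j \<in> J" for j
        proof -
          have "(\<Sum>k\<in>K. (l(m := r)) k * A k j) = (\<Sum>k\<in>K. l k * A k j)"
            using insert.hyps by (intro sum.cong) auto
          moreover have "g j - ?dot g x / c * A m j =
              (\<Sum>k\<in>K. l k * A k j) - (\<Sum>k\<in>K. l k * ?dot (A k) x) / c * A m j"
          proof -
            have "g j - ?dot g x / c * A m j = (\<Sum>k\<in>K. l k * (A k j - ?dot (A k) x / c * A m j))"
              using comb'(2) that by (simp add: proj_def)
            also have "\<dots> = (\<Sum>k\<in>K. l k * A k j) - (\<Sum>k\<in>K. l k * ?dot (A k) x / c * A m j)"
              by (simp add: right_diff_distrib sum_subtractf mult.assoc)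
            also have "\<dots> = (\<Sum>k\<in>K. l k * A k j) - (\<Sum>k\<in>K. l k * ?dot (A k) x) / c * A m j"
              by (simp only: sum_distrib_right sum_divide_distrib)
            finally show ?thesis .
          qed
          ultimately show ?thesis
            using insert.hyps c by (simp add: r_def diff_divide_distrib left_diff_distrib)
        qed
        with r comb'(1) insert.hyps show ?thesis
          by (intro disjI1 exI[of _ "l(m := r)"]) auto
      next
        case sep'
        define w where "w j = z j - ?dot (A m) z / c * x j" for j
        have "?dot (proj u) z = ?dot u w" for u
          by (simp add: dot_proj w_def)
        moreover have "?dot (A m) w = 0"
        proof -
          have "?dot (A m) w = ?dot (proj (A m)) z" by (simp add: dot_proj w_def)
          also have "proj (A m) = (\<lambda>_. 0)" using c by (auto simp: proj_def c_def[symmetric])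
          finally show ?thesis by simp
        qed
        ultimately show ?thesis
          using sep' by (intro disjI2 exI[of _ w]) auto
      qed
    qed
  qed
qed

text \<open>
  Farkas' alternative for the system \<open>t A - s = - 1 A\<close> in \<open>t, s \<ge> 0\<close>, where \<open>1\<close> is the all-ones row:
  a solution gives the strictly positive vector \<open>\<theta> = 1 + t\<close>.
\<close>

lemma stiemke_alternative:
  fixes A :: "'i \<Rightarrow> 'i \<Rightarrow> real"
  assumes I: "finite I"
  shows "(\<exists>\<theta>. (\<forall>i\<in>I. 0 < \<theta> i) \<and> (\<forall>i\<in>I. 0 \<le> (\<Sum>j\<in>I. \<theta> j * A j i))) \<or>
         (\<exists>y. (\<forall>i\<in>I. 0 \<le> y i) \<and> (\<forall>j\<in>I. (\<Sum>i\<in>I. A j i * y i) \<le> 0) \<and>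
              (\<exists>j\<in>I. (\<Sum>i\<in>I. A j i * y i) < 0))"
proof -
  define B :: "'i + 'i \<Rightarrow> 'i \<Rightarrow> real"
    where "B k i = (case k of Inl j \<Rightarrow> A j i | Inr j \<Rightarrow> if j = i then - 1 else 0)" for k i
  define g where "g i = - (\<Sum>j\<in>I. A j i)" for i
  consider (comb) l where "\<forall>k\<in>I <+> I. 0 \<le> l k" "\<forall>i\<in>I. g i = (\<Sum>k\<in>I <+> I. l k * B k i)"
    | (sep) y where "\<forall>k\<in>I <+> I. (\<Sum>i\<in>I. B k i * y i) \<le> 0" "0 < (\<Sum>i\<in>I. g i * y i)"
    using farkas_alternative[of "I <+> I" I g B] I by auto
  then show ?thesis
  proof cases
    case comb
    have "0 \<le> (\<Sum>j\<in>I. (1 + l (Inl j)) * A j i)" if "i \<in> I" for i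
    proof -
      have "g i = (\<Sum>j\<in>I. l (Inl j) * A j i) + (\<Sum>j\<in>I. l (Inr j) * (if j = i then - 1 else 0))"
        using comb(2) that I by (simp add: sum.Plus B_def o_def)
      also have "(\<Sum>j\<in>I. l (Inr j) * (if j = i then - 1 else 0)) = - l (Inr i)"
        using that I by (simp add: if_distrib[of "\<lambda>t. _ * t"] cong: if_cong)
      finally have "(\<Sum>j\<in>I. (1 + l (Inl j)) * A j i) = l (Inr i)"
        by (simp add: g_def distrib_right sum.distrib)
      then show ?thesis using comb(1) that by auto
    qed
    moreover have "0 < 1 + l (Inl i)" if "i \<in> I" for i
    proof -
      have "0 \<le> l (Inl i)" using comb(1) that by auto
      then show ?thesis by simp
    qed
    ultimately show ?thesis
      by (intro disjI1 exI[of _ "\<lambda>j. 1 + l (Inl j)"]) auto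
  next
    case sep
    have le: "(\<Sum>i\<in>I. A j i * y i) \<le> 0" if "j \<in> I" for j
      using bspec[OF sep(1), of "Inl j"] that by (auto simp: B_def)
    have nonneg: "0 \<le> y j" if "j \<in> I" for j
      using bspec[OF sep(1), of "Inr j"] that I
      by (auto simp: B_def if_distrib[of "\<lambda>t. t * _"] cong: if_cong)
    have "(\<Sum>i\<in>I. g i * y i) = - (\<Sum>j\<in>I. \<Sum>i\<in>I. A j i * y i)"
      by (subst sum.swap) (simp add: g_def sum_distrib_right sum_negf)
    with sep(2) have "(\<Sum>j\<in>I. \<Sum>i\<in>I. A j i * y i) \<noteq> 0" by simp
    then have "\<exists>j\<in>I. (\<Sum>i\<in>I. A j i * y i) \<noteq> 0" by (meson sum.neutral)
    with le nonneg show ?thesis by (metis less_eq_real_def)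
  qed
qed

section \<open>Young splittings\<close>

text \<open>
  For positive \<open>u\<close> and \<open>v\<close> this says \<open>0 \<le> x \<le> u\<^bsup>1/p\<^esup> v\<^bsup>1-1/p\<^esup>\<close>. In the form of Young's inequality, which
  is linear in \<open>x\<close>, \<open>u\<close> and \<open>v\<close>, the relation is preserved by sums at sight, with no appeal to
  Hoelder's inequality. The clause for \<open>u = 0\<close> makes the right side strictly positive at \<open>t = 0\<close>
  when \<open>x\<close> and \<open>s\<close> are positive.
\<close>

definition young_split :: "real \<Rightarrow> real \<Rightarrow> real \<Rightarrow> real \<Rightarrow> bool" where
  "young_split p x u v \<longleftrightarrow> 0 \<le> x \<and> 0 \<le> u \<and> 0 \<le> v \<and> (u = 0 \<longrightarrow> x = 0) \<and>
     (\<forall>s>0. \<forall>t>0. x * (s * t powr (p - 1)) \<le> u / p * s powr p + (1 - 1 / p) * v * t powr p)"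

lemma young_split_zero: "1 \<le> p \<Longrightarrow> 0 \<le> u \<Longrightarrow> 0 \<le> v \<Longrightarrow> young_split p 0 u v"
  by (simp add: young_split_def)

lemma young_split_add:
  assumes "young_split p x u v" "young_split p x' u' v'"
  shows "young_split p (x + x') (u + u') (v + v')"
proof -
  have "(x + x') * (s * t powr (p - 1)) \<le> (u + u') / p * s powr p + (1 - 1 / p) * (v + v') * t powr p"
    if "s > 0" "t > 0" for s t
  proof -
    have "x * (s * t powr (p - 1)) \<le> u / p * s powr p + (1 - 1 / p) * v * t powr p"
      and "x' * (s * t powr (p - 1)) \<le> u' / p * s powr p + (1 - 1 / p) * v' * t powr p"
      using assms that by (auto simp: young_split_def)
    then show ?thesis by (simp add: add_divide_distrib distrib_left distrib_right)
  qed
  with assms show ?thesis by (auto simp: young_split_def)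
qed

lemma young_split_scale:
  assumes "young_split p x u v" "0 \<le> c"
  shows "young_split p (c * x) (c * u) (c * v)"
proof -
  have "c * x * (s * t powr (p - 1)) \<le> c * u / p * s powr p + (1 - 1 / p) * (c * v) * t powr p"
    if "s > 0" "t > 0" for s t
  proof -
    have "x * (s * t powr (p - 1)) \<le> u / p * s powr p + (1 - 1 / p) * v * t powr p"
      using assms that by (auto simp: young_split_def)
    from mult_left_mono[OF this \<open>0 \<le> c\<close>] show ?thesis by (simp add: algebra_simps)
  qed
  with assms show ?thesis by (auto simp: young_split_def)
qed

text \<open>The weighted arithmetic-geometric mean inequality for \<open>u s\<^sup>p\<close> and \<open>v t\<^sup>p\<close>.\<close>

lemma young_splitI:
  assumes p: "1 \<le> p" and pos: "0 < u" "0 < v" and x: "0 \<le> x" "x \<le> u powr (1 / p) * v powr (1 - 1 / p)"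
  shows "young_split p x u v"
proof -
  have "x * (s * t powr (p - 1)) \<le> u / p * s powr p + (1 - 1 / p) * v * t powr p"
    if st: "s > 0" "t > 0" for s t
  proof -
    have "x * (s * t powr (p - 1)) \<le> (u powr (1 / p) * v powr (1 - 1 / p)) * (s * t powr (p - 1))"
      using x st by (intro mult_right_mono) auto
    also have "\<dots> = (u * s powr p) powr (1 / p) * (v * t powr p) powr (1 - 1 / p)"
      using p pos st by (simp add: powr_mult powr_powr right_diff_distrib)
    also have "\<dots> \<le> 1 / p * (u * s powr p) + (1 - 1 / p) * (v * t powr p)"
      using p pos st by (intro Youngs_inequality_0) auto
    finally show ?thesis by (simp add: mult.assoc)
  qed
  with assms show ?thesis by (auto simp: young_split_def)
qed

lemma young_split_self:
  assumes "1 \<le> p" "0 \<le> x"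
  shows "young_split p x x x"
proof (cases "x = 0")
  case False
  with assms show ?thesis
    by (intro young_splitI) (auto simp: powr_add[symmetric])
qed (use assms in \<open>simp add: young_split_zero\<close>)

lemma rpow_nonneg: "0 \<le> rpow x s"
  by (simp add: rpow_def)

lemma rpow_pos: "0 < x \<Longrightarrow> rpow x s = x powr s"
  by (simp add: rpow_def)

lemma young_split_rpow:
  assumes p: "1 \<le> p" and q: "1 < p \<Longrightarrow> 1 / p + 1 / q = 1" and x: "0 \<le> x" and \<alpha>: "p = 1 \<Longrightarrow> \<alpha> = 1"
  shows "young_split p x (rpow x (\<alpha> * p)) (rpow x ((1 - \<alpha>) * q))"
proof (cases "x = 0")
  case True
  with p show ?thesis by (simp add: young_split_zero rpow_nonneg)
next
  case False
  have "(1 - \<alpha>) * (q * (1 - 1 / p)) = 1 - \<alpha>"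
  proof (cases "p = 1")
    case False
    with p q have "1 - 1 / p = 1 / q" "1 / q \<noteq> 0" by (auto simp: field_simps)
    then show ?thesis by simp
  qed (use \<alpha> in simp)
  with False p x show ?thesis
    by (intro young_splitI) (auto simp: rpow_pos powr_powr powr_add[symmetric] mult.assoc)
qed

section \<open>Positive vectors from mixed row and column sums\<close>

text \<open>
  Ostrowski's argument, as sketched at the beginning. An index \<open>j\<close> with \<open>y\<^sub>j = 0\<close> may be the only one
  at which the inequality \<open>D\<^sub>j y\<^sub>j \<le> (C y)\<^sub>j\<close> is strict; the factor \<open>y\<^sub>j\<^bsup>p-1\<^esup>\<close> then destroys the
  strictness, which is recovered from \<open>U\<^sub>j\<^sub>i y\<^sub>i\<^sup>p > 0\<close> for some \<open>i\<close>.
\<close>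

lemma ostrowski_positive_vector:
  fixes C U V :: "'i \<Rightarrow> 'i \<Rightarrow> real" and D \<xi> :: "'i \<Rightarrow> real"
  assumes I: "finite I" and p: "1 \<le> p"
    and split: "\<And>i j. i \<in> I \<Longrightarrow> j \<in> I \<Longrightarrow> young_split p (C j i) (U j i) (V j i)"
    and xi: "\<And>i. i \<in> I \<Longrightarrow> 0 < \<xi> i"
    and bound: "\<And>i. i \<in> I \<Longrightarrow>
      1 / p * (\<Sum>j\<in>I. \<xi> j * U j i) + (1 - 1 / p) * \<xi> i * (\<Sum>j\<in>I. V i j) \<le> \<xi> i * D i"
  shows "\<exists>\<theta>. (\<forall>i\<in>I. 0 < \<theta> i) \<and> (\<forall>i\<in>I. (\<Sum>j\<in>I. \<theta> j * C j i) \<le> D i * \<theta> i)"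
proof -
  define A where "A j i = (if j = i then D i else 0) - C j i" for j i
  have row: "(\<Sum>j\<in>I. \<theta> j * A j i) = D i * \<theta> i - (\<Sum>j\<in>I. \<theta> j * C j i)" if "i \<in> I" for \<theta> i
    using that I by (simp add: A_def right_diff_distrib sum_subtractf if_distrib[of "\<lambda>t. _ * t"]
        mult.commute cong: if_cong)
  have col: "(\<Sum>i\<in>I. A j i * y i) = D j * y j - (\<Sum>i\<in>I. C j i * y i)" if "j \<in> I" for y j
    using that I by (simp add: A_def left_diff_distrib sum_subtractf if_distrib[of "\<lambda>t. t * _"]
        cong: if_cong)
  have no_dual: False
    if y: "\<forall>i\<in>I. 0 \<le> y i" and le: "\<forall>j\<in>I. (\<Sum>i\<in>I. A j i * y i) \<le> 0"
      and j0: "j0 \<in> I" "(\<Sum>i\<in>I. A j0 i * y i) < 0" for y j0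
  proof -
    define L where "L j = D j * y j powr p" for j
    define R where "R j = (\<Sum>i\<in>I. U j i / p * y i powr p + (1 - 1 / p) * V j i * y j powr p)" for j
    have nonneg: "0 \<le> U j i" "0 \<le> V j i" "0 \<le> 1 - 1 / p" if "i \<in> I" "j \<in> I" for i j
      using split[OF that] p by (auto simp: young_split_def)
    have term_nonneg: "0 \<le> U j i / p * y i powr p + (1 - 1 / p) * V j i * y j powr p"
      if "i \<in> I" "j \<in> I" for i j
      using nonneg[OF that] p by simp
    have powr: "y j * y j powr (p - 1) = y j powr p" if "y j > 0" for j
      using that powr_mult_base[of "y j" "p - 1"] by simp
    have young: "C j i * y i * y j powr (p - 1) \<le> U j i / p * y i powr p + (1 - 1 / p) * V j i * y j powr p"
      if "i \<in> I" "j \<in> I" for i j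
    proof (cases "y i = 0 \<or> y j = 0")
      case True
      then show ?thesis using term_nonneg[OF that] by auto
    next
      case False
      then have "y i > 0" "y j > 0" using y that by (auto simp: less_le)
      then show ?thesis using split[OF that] by (auto simp: young_split_def mult.assoc)
    qed
    have sum_young: "(\<Sum>i\<in>I. C j i * y i) * y j powr (p - 1) \<le> R j" if "j \<in> I" for j
      unfolding R_def sum_distrib_right using young that by (intro sum_mono) auto
    have LR: "L j \<le> R j" if j: "j \<in> I" for j
    proof (cases "y j = 0")
      case True
      have "0 \<le> R j" unfolding R_def using term_nonneg[OF _ j] by (intro sum_nonneg) auto
      with True show ?thesis by (simp add: L_def)
    next
      case False
      then have pos: "y j > 0" using y j by (auto simp: less_le)
      have "L j = D j * y j * y j powr (p - 1)" using powr[OF pos] by (simp add: L_def mult.assoc)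
      also have "\<dots> \<le> (\<Sum>i\<in>I. C j i * y i) * y j powr (p - 1)"
        using le j by (intro mult_right_mono) (auto simp: col)
      finally show ?thesis using sum_young[OF j] by simp
    qed
    have LR0: "L j0 < R j0"
    proof (cases "y j0 = 0")
      case True
      have "0 < (\<Sum>i\<in>I. C j0 i * y i)" using j0 True by (simp add: col)
      then obtain i where i: "i \<in> I" "C j0 i * y i > 0"
        using sum_nonpos[of I "\<lambda>i. C j0 i * y i"] by (meson linorder_not_less)
      then have "y i > 0" "U j0 i > 0"
        using y split[OF i(1) j0(1)] by (auto simp: young_split_def zero_less_mult_iff less_le)
      then have "0 < U j0 i / p * y i powr p + (1 - 1 / p) * V j0 i * y j0 powr p"
        using p True by simp
      then have "0 < R j0" unfolding R_def
        using i term_nonneg[OF _ j0(1)] by (intro sum_pos2[OF I, of i]) auto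
      with True show ?thesis by (simp add: L_def)
    next
      case False
      then have pos: "y j0 > 0" using y j0 by (auto simp: less_le)
      have "L j0 = D j0 * y j0 * y j0 powr (p - 1)" using powr[OF pos] by (simp add: L_def mult.assoc)
      also have "\<dots> < (\<Sum>i\<in>I. C j0 i * y i) * y j0 powr (p - 1)"
        using j0 pos by (intro mult_strict_right_mono) (auto simp: col)
      finally show ?thesis using sum_young[OF j0(1)] by simp
    qed
    have "(\<Sum>j\<in>I. \<xi> j * L j) < (\<Sum>j\<in>I. \<xi> j * R j)"
    proof (rule sum_strict_mono_ex1[OF I])
      show "\<forall>j\<in>I. \<xi> j * L j \<le> \<xi> j * R j" using LR xi by (simp add: less_imp_le)
      show "\<exists>j\<in>I. \<xi> j * L j < \<xi> j * R j" using LR0 j0 xi by auto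
    qed
    also have "\<dots> = (\<Sum>j\<in>I. \<Sum>i\<in>I. y i powr p * (1 / p * (\<xi> j * U j i)))
        + (\<Sum>j\<in>I. \<Sum>i\<in>I. y j powr p * ((1 - 1 / p) * \<xi> j * V j i))"
      by (simp add: R_def sum_distrib_left sum.distrib[symmetric] distrib_left mult.assoc mult.left_commute
          mult.commute)
    also have "\<dots> = (\<Sum>i\<in>I. y i powr p *
        (1 / p * (\<Sum>j\<in>I. \<xi> j * U j i) + (1 - 1 / p) * \<xi> i * (\<Sum>j\<in>I. V i j)))"
      by (subst sum.swap) (simp only: sum_distrib_left[symmetric] sum.distrib[symmetric] distrib_left[symmetric])
    also have "\<dots> \<le> (\<Sum>i\<in>I. y i powr p * (\<xi> i * D i))"
      using bound by (intro sum_mono mult_left_mono) auto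
    also have "\<dots> = (\<Sum>j\<in>I. \<xi> j * L j)"
      by (simp add: L_def ac_simps)
    finally show False by simp
  qed
  from stiemke_alternative[OF I, of A] no_dual
  obtain \<theta> where "\<forall>i\<in>I. 0 < \<theta> i" "\<forall>i\<in>I. 0 \<le> (\<Sum>j\<in>I. \<theta> j * A j i)" by blast
  then show ?thesis by (intro exI[of _ \<theta>]) (auto simp: row)
qed

section \<open>The two sets of inequalities\<close>

lemma sum_if_neq:
  fixes f :: "'a \<Rightarrow> real"
  assumes "finite I"
  shows "(\<Sum>j\<in>I. if j = i then 0 else f j) = (\<Sum>j\<in>I - {i}. f j)"
    and "(\<Sum>j\<in>I. if i = j then 0 else f j) = (\<Sum>j\<in>I - {i}. f j)"
proof -
  show "(\<Sum>j\<in>I. if j = i then 0 else f j) = (\<Sum>j\<in>I - {i}. f j)"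
    using assms by (intro sum.mono_neutral_cong_right) auto
  then show "(\<Sum>j\<in>I. if i = j then 0 else f j) = (\<Sum>j\<in>I - {i}. f j)"
    by (simp add: eq_commute)
qed

text \<open>
  The common form of both sets of inequalities, with \<open>k\<^sub>j\<^sub>i\<close> standing for \<open>e\<^bsup>\<epsilon>\<tau>\<^sub>j\<^sub>i\<^esup>\<close>. The diagonal of \<open>a\<close>
  goes into \<open>D\<close>, whereas the diagonal of \<open>b\<close> is split like the other entries.
\<close>

lemma positive_weights:
  fixes a b ua va ub vb k :: "'i \<Rightarrow> 'i \<Rightarrow> real" and c G F \<xi> :: "'i \<Rightarrow> real"
  assumes I: "finite I" and p: "1 \<le> p"
    and G: "\<And>i. i \<in> I \<Longrightarrow> 0 < G i" and F: "\<And>i. i \<in> I \<Longrightarrow> 0 < F i"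
    and xi: "\<And>i. i \<in> I \<Longrightarrow> 0 < \<xi> i"
    and k: "\<And>i j. 0 \<le> k i j"
    and a: "\<And>i j. i \<in> I \<Longrightarrow> j \<in> I \<Longrightarrow> young_split p \<bar>a i j\<bar> (ua i j) (va i j)"
    and b: "\<And>i j. i \<in> I \<Longrightarrow> j \<in> I \<Longrightarrow> young_split p \<bar>b i j\<bar> (ub i j) (vb i j)"
    and ineq: "\<And>i. i \<in> I \<Longrightarrow>
          c i * \<xi> i
          + G i * (\<xi> i * \<bar>a i i\<bar> + 1 / p * (\<Sum>j\<in>I - {i}. \<xi> j * ua j i))
          + (1 - 1 / p) * \<xi> i * (\<Sum>j\<in>I - {i}. G j * va i j)
          + 1 / p * F i * (\<Sum>j\<in>I. \<xi> j * ub j i * k j i)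
          + (1 - 1 / p) * \<xi> i * (\<Sum>j\<in>I. F j * vb i j * k i j)
          \<le> 0"
  shows "\<exists>\<theta>. (\<forall>i\<in>I. \<theta> i > 0) \<and>
           (\<forall>i\<in>I.
              c i * \<theta> i
              + G i * (\<theta> i * \<bar>a i i\<bar> + (\<Sum>j\<in>I - {i}. \<theta> j * \<bar>a j i\<bar>))
              + F i * (\<Sum>j\<in>I. \<theta> j * \<bar>b j i\<bar> * k j i)
              \<le> 0)"
proof -
  define mix where "mix f g j i = (if j = i then 0 else G i * f j i) + F i * k j i * g j i"
    for f g :: "'i \<Rightarrow> 'i \<Rightarrow> real" and j i
  define D where "D i = - c i - G i * \<bar>a i i\<bar>" for i
  have split: "young_split p (mix (\<lambda>j i. \<bar>a j i\<bar>) (\<lambda>j i. \<bar>b j i\<bar>) j i) (mix ua ub j i) (mix va vb j i)"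
    if "i \<in> I" "j \<in> I" for i j
    unfolding mix_def using that p a b G F k
    by (intro young_split_add) (auto intro!: young_split_scale young_split_zero simp: less_imp_le)
  have column: "(\<Sum>j\<in>I. w j * mix f g j i) =
      G i * (\<Sum>j\<in>I - {i}. w j * f j i) + F i * (\<Sum>j\<in>I. w j * g j i * k j i)" for w f g i
  proof -
    have "(\<Sum>j\<in>I. w j * mix f g j i) =
        (\<Sum>j\<in>I. if j = i then 0 else G i * (w j * f j i)) + (\<Sum>j\<in>I. F i * (w j * g j i * k j i))"
      unfolding sum.distrib[symmetric] by (intro sum.cong) (auto simp: mix_def algebra_simps)
    then show ?thesis using I by (simp add: sum_if_neq sum_distrib_left)
  qed
  have row: "(\<Sum>j\<in>I. mix f g i j) = (\<Sum>j\<in>I - {i}. G j * f i j) + (\<Sum>j\<in>I. F j * g i j * k i j)"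
    for f g i
    using I by (simp add: mix_def sum.distrib sum_if_neq ac_simps)
  have "1 / p * (\<Sum>j\<in>I. \<xi> j * mix ua ub j i) + (1 - 1 / p) * \<xi> i * (\<Sum>j\<in>I. mix va vb i j) \<le> \<xi> i * D i"
    if "i \<in> I" for i
    using ineq[OF that] unfolding column row D_def by (simp add: algebra_simps)
  from ostrowski_positive_vector[OF I p split xi this]
  obtain \<theta> where "\<forall>i\<in>I. 0 < \<theta> i"
    and "\<forall>i\<in>I. (\<Sum>j\<in>I. \<theta> j * mix (\<lambda>j i. \<bar>a j i\<bar>) (\<lambda>j i. \<bar>b j i\<bar>) j i) \<le> D i * \<theta> i"
    by blast
  then show ?thesis
    by (intro exI[of _ \<theta>]) (auto simp: column D_def algebra_simps)
qed

theorem theorem6: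
  fixes n :: nat
    and p q \<epsilon> :: real
    and d G F \<xi> :: "nat \<Rightarrow> real"
    and a b \<tau> \<alpha> \<beta> :: "nat \<Rightarrow> nat \<Rightarrow> real"
  assumes p: "1 \<le> p"
    and q: "1 < p \<Longrightarrow> 1 / p + 1 / q = 1"
    and d: "\<And>i. i \<in> {1..n} \<Longrightarrow> d i > 0"
    and G: "\<And>i. i \<in> {1..n} \<Longrightarrow> G i > 0"
    and F: "\<And>i. i \<in> {1..n} \<Longrightarrow> F i > 0"
    and tau: "\<And>i j. i \<in> {1..n} \<Longrightarrow> j \<in> {1..n} \<Longrightarrow> \<tau> i j \<ge> 0"
    and eps: "\<epsilon> > 0"
    and xi: "\<And>i. i \<in> {1..n} \<Longrightarrow> \<xi> i > 0"
    and p1: "\<And>i j. p = 1 \<Longrightarrow> i \<in> {1..n} \<Longrightarrow> j \<in> {1..n} \<Longrightarrow> \<alpha> i j = 1 \<and> \<beta> i j = 1"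
    and ineq:
      "(\<forall>i\<in>{1..n}.
          (- d i + \<epsilon>) * \<xi> i
          + G i * (\<xi> i * \<bar>a i i\<bar>
                   + 1 / p * (\<Sum>j\<in>{1..n} - {i}. \<xi> j * rpow \<bar>a j i\<bar> (\<alpha> j i * p)))
          + conj_recip p q * \<xi> i
              * (\<Sum>j\<in>{1..n} - {i}. G j * rpow \<bar>a i j\<bar> ((1 - \<alpha> i j) * q))
          + 1 / p * F i
              * (\<Sum>j\<in>{1..n}. \<xi> j * rpow \<bar>b j i\<bar> (\<beta> j i * p) * exp (\<epsilon> * \<tau> j i))
          + conj_recip p q * \<xi> i
              * (\<Sum>j\<in>{1..n}. F j * rpow \<bar>b i j\<bar> ((1 - \<beta> i j) * q) * exp (\<epsilon> * \<tau> i j))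
          \<le> 0)
       \<or>
       (\<forall>i\<in>{1..n}.
          (- d i + \<epsilon>) * \<xi> i
          + G i * (\<xi> i * \<bar>a i i\<bar> + 1 / p * (\<Sum>j\<in>{1..n} - {i}. \<xi> j * \<bar>a j i\<bar>))
          + conj_recip p q * \<xi> i * (\<Sum>j\<in>{1..n} - {i}. G j * \<bar>a i j\<bar>)
          + 1 / p * F i * (\<Sum>j\<in>{1..n}. \<xi> j * \<bar>b j i\<bar> * exp (\<epsilon> * \<tau> j i))
          + conj_recip p q * \<xi> i * (\<Sum>j\<in>{1..n}. F j * \<bar>b i j\<bar> * exp (\<epsilon> * \<tau> i j))
          \<le> 0)"
  shows "\<exists>\<theta> :: nat \<Rightarrow> real.
           (\<forall>i\<in>{1..n}. \<theta> i > 0) \<and>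
           (\<forall>i\<in>{1..n}.
              (- d i + \<epsilon>) * \<theta> i
              + G i * (\<theta> i * \<bar>a i i\<bar> + (\<Sum>j\<in>{1..n} - {i}. \<theta> j * \<bar>a j i\<bar>))
              + F i * (\<Sum>j\<in>{1..n}. \<theta> j * \<bar>b j i\<bar> * exp (\<epsilon> * \<tau> j i))
              \<le> 0)"
proof -
  have recip: "conj_recip p q = 1 - 1 / p"
    using p q by (auto simp: conj_recip_def algebra_simps)
  note weights = positive_weights[where I = "{1..n}" and p = p and G = G and F = F and \<xi> = \<xi>
      and k = "\<lambda>i j. exp (\<epsilon> * \<tau> i j)" and a = a and b = b and c = "\<lambda>i. - d i + \<epsilon>",
      OF finite_atLeastAtMost p G F xi exp_ge_zero]
  from ineq show ?thesis
    unfolding recip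
  proof (elim disjE, goal_cases)
    case 1
    show ?case
      using p1 1
      by (intro weights[where ua = "\<lambda>i j. rpow \<bar>a i j\<bar> (\<alpha> i j * p)"
            and va = "\<lambda>i j. rpow \<bar>a i j\<bar> ((1 - \<alpha> i j) * q)"
            and ub = "\<lambda>i j. rpow \<bar>b i j\<bar> (\<beta> i j * p)"
            and vb = "\<lambda>i j. rpow \<bar>b i j\<bar> ((1 - \<beta> i j) * q)"] young_split_rpow p q) auto
  next
    case 2
    then show ?case
      by (intro weights[where ua = "\<lambda>i j. \<bar>a i j\<bar>" and va = "\<lambda>i j. \<bar>a i j\<bar>"
            and ub = "\<lambda>i j. \<bar>b i j\<bar>" and vb = "\<lambda>i j. \<bar>b i j\<bar>"] young_split_self p) auto
  qed
qed

end
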